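(* Let $S$ be a type-space functor with enough countable models (i.e. $S_{\mathcal W}$ dense in $S_\omega$). Then $S$ has the game omitting types property if and only if $S_{\mathcal W}$ is completely weakly $\alpha$-favourable.
   Context: Regard each natural number $n$ as the set $\{0,\dots,n-1\}$. A type-space functor $S$ assigns to each $n<\omega$ a topological space $S_n$ and to each function $f:n\to m$ a continuous open map $Sf:S_m\to S_n$ such that $S(g\circ f)=(Sf)\circ(Sg)$, $S(\mathrm{id}_n)=\mathrm{id}_{S_n}$, and a weak amalgamation condition holds (for every $m$, $p\in S_m$, $q\in(Si_m)^{-1}(\{p\})$ and non-empty open $U\subseteq(Si_m)^{-1}(\{p\})$ there is $r\in S_{m+2}$ with $(Si_{m+1})(r)=q$ and $(Sd_m)(r)\in U$, where $i_k:k\to k+1$ is the inclusion and $d_m(j)=j$ for $j<m$, $d_m(m)=m+1$). For $n\le m$, $\iota_{n,m}:n\to m$ is the inclusion. $S_\omega=\{(a_n)_{n<\omega}\in\prod_n S_n : a_n=(S\iota_{n,m})(a_m)\ \forall n<m\}$ with the product subspace topology; for $f:n\to\omega$, $Sf:S_\omega\to S_n$ is $(Sf)((a_j)_j)=(Sf')(a_m)$ where $f[n]\subseteq m$ and $f':n\to m$ agrees with $f$. A model of size $\omega$ for $S$ is a function $M$ on $[\omega]^{<\omega}$ such that for every $A=\{a_0<\dots<a_{n-1}\}\in[\omega]^n$: (1) $M(A)\in S_n$; (2) if $B=\{b_0<\dots<b_{m-1}\}\supseteq A$ and $g:n\to m$ satisfies $a_i=b_{g(i)}$ then $M(A)=(Sg)(M(B))$;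 (3) for every $m\ge n$ and open $U\subseteq(S\iota_{n,m})^{-1}(\{M(A)\})$ there are $B=\{b_0<\dots<b_{m-1}\}\in[\omega]^m$, $B\supseteq A$, and a permutation $g$ of $m$ with $a_i=b_{g(i)}$ for $i<n$ and $(Sg)(M(B))\in U$. For $\sigma\in S_\omega$, $M_\sigma(A)=(Sf_A)(\sigma)$ where $f_A$ enumerates $A$ increasingly; $S_{\mathcal W}=\{\sigma\in S_\omega: M_\sigma\text{ is a model}\}$ with the subspace topology. A partial $\omega$-type is a closed subset of $S_\omega$. For a partial $\omega$-type $C$, a set $F\subseteq S_\omega$ is omissible in a model realizing $C$ if there is $\sigma\in S_{\mathcal W}\cap C$ with $\sigma\notin F$. The omitting types game on $C$: players REALIZE and OMIT alternately choose partial $\omega$-types $F_0\subseteq F_1\subseteq\cdots$, REALIZE choosing first, each $F_i$ being omissible in a model realizing $C$; OMIT wins if $\bigcup_n F_n$ is omissible in a model realizing $C$, otherwise REALIZE wins. $S$ has the game omitting types property if OMIT has a winning strategy in the omitting types game on $C$ for every partial $\omega$-type $C$. The Banach–Mazur game on a space $Y$: players EMPTY and NONEMPTY alternately choose non-empty open sets $O_0\supseteq O_1\supseteq\cdots$, EMPTY first; NONEMPTY wins if $\bigcap_n O_n\neq\emptyset$. $Y$ is weakly $\alpha$-favourable if NONEMPTY has a winning strategy, and completely weakly $\alpha$-favourable if every closed subspace of $Y$ is weakly $\alpha$-favourable. *)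

theory Defs
  imports "HOL-Analysis.Analysis" "HOL-Library.FuncSet" "HOL-Library.Infinite_Set"
begin

text \<open>
  The natural number \<open>n\<close> is the set \<open>{..<n}\<close>, and a function \<open>f : n \<rightarrow> m\<close> is an element of
  \<open>{..<n} \<rightarrow>\<^sub>E {..<m}\<close>, so that equal functions are equal terms.  A type-space functor is given
  by the spaces \<open>X n\<close> and, for \<open>f : n \<rightarrow> m\<close>, the map \<open>S n m f\<close> from \<open>X m\<close> to \<open>X n\<close>; its
  domain and codomain are passed explicitly because \<open>f\<close> does not determine them.
  Taking all spaces over one type is no restriction: use a sum type.
\<close>

definition incl :: "nat \<Rightarrow> nat \<Rightarrow> nat" where
  "incl n = (\<lambda>i\<in>{..<n}. i)"

definition skip_last :: "nat \<Rightarrow> nat \<Rightarrow> nat" where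
  "skip_last m = (\<lambda>j\<in>{..<Suc m}. if j < m then j else Suc m)"

definition fibre ::
  "(nat \<Rightarrow> 'a topology) \<Rightarrow> (nat \<Rightarrow> nat \<Rightarrow> (nat \<Rightarrow> nat) \<Rightarrow> 'a \<Rightarrow> 'a) \<Rightarrow> nat \<Rightarrow> nat \<Rightarrow> 'a \<Rightarrow> 'a set" where
  "fibre X S n m p = {q \<in> topspace (X m). S n m (incl n) q = p}"

text \<open>
  Open subsets of a fibre are meant in the subspace topology of the fibre.
\<close>

locale type_space_functor =
  fixes X :: "nat \<Rightarrow> 'a topology"
    and S :: "nat \<Rightarrow> nat \<Rightarrow> (nat \<Rightarrow> nat) \<Rightarrow> 'a \<Rightarrow> 'a"
  assumes continuous:
      "\<And>n m f. f \<in> {..<n} \<rightarrow>\<^sub>E {..<m} \<Longrightarrow> continuous_map (X m) (X n) (S n m f)"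
    and open_map:
      "\<And>n m f. f \<in> {..<n} \<rightarrow>\<^sub>E {..<m} \<Longrightarrow> open_map (X m) (X n) (S n m f)"
    and comp:
      "\<And>n m k f g p. \<lbrakk>f \<in> {..<n} \<rightarrow>\<^sub>E {..<m}; g \<in> {..<m} \<rightarrow>\<^sub>E {..<k}; p \<in> topspace (X k)\<rbrakk>
        \<Longrightarrow> S n k (compose {..<n} g f) p = S n m f (S m k g p)"
    and ident:
      "\<And>n p. p \<in> topspace (X n) \<Longrightarrow> S n n (\<lambda>i\<in>{..<n}. i) p = p"
    and weak_amalgamation:
      "\<And>m p q U. \<lbrakk>p \<in> topspace (X m); q \<in> fibre X S m (Suc m) p;
          openin (subtopology (X (Suc m)) (fibre X S m (Suc m) p)) U; U \<noteq> {}\<rbrakk>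
        \<Longrightarrow> \<exists>r\<in>topspace (X (Suc (Suc m))).
              S (Suc m) (Suc (Suc m)) (incl (Suc m)) r = q \<and>
              S (Suc m) (Suc (Suc m)) (skip_last m) r \<in> U"

definition omega_space ::
  "(nat \<Rightarrow> 'a topology) \<Rightarrow> (nat \<Rightarrow> nat \<Rightarrow> (nat \<Rightarrow> nat) \<Rightarrow> 'a \<Rightarrow> 'a) \<Rightarrow> (nat \<Rightarrow> 'a) topology" where
  "omega_space X S =
     subtopology (product_topology X UNIV)
       {a. \<forall>n m. n < m \<longrightarrow> a n = S n m (incl n) (a m)}"

text \<open>
  For \<open>f : n \<rightarrow> \<omega>\<close>, any \<open>m\<close> with \<open>f[n] \<subseteq> m\<close> gives the same value on the points of
  \<open>omega_space X S\<close> (lemma \<open>omega_map_eq\<close> below); the least one is chosen.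
\<close>

definition omega_map ::
  "(nat \<Rightarrow> nat \<Rightarrow> (nat \<Rightarrow> nat) \<Rightarrow> 'a \<Rightarrow> 'a) \<Rightarrow> nat \<Rightarrow> (nat \<Rightarrow> nat) \<Rightarrow> (nat \<Rightarrow> 'a) \<Rightarrow> 'a" where
  "omega_map S n f a = (let m = (LEAST m. f ` {..<n} \<subseteq> {..<m}) in S n m f (a m))"

lemma (in type_space_functor) omega_map_eq:
  assumes a: "a \<in> topspace (omega_space X S)" and f: "f \<in> {..<n} \<rightarrow>\<^sub>E {..<m}"
  shows "omega_map S n f a = S n m f (a m)"
proof -
  define k where "k = (LEAST m. f ` {..<n} \<subseteq> {..<m})"
  have fm: "f ` {..<n} \<subseteq> {..<m}" using f by (auto simp: PiE_iff)
  have "f ` {..<n} \<subseteq> {..<k}" unfolding k_def using fm by (rule LeastI)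
  then have fk: "f \<in> {..<n} \<rightarrow>\<^sub>E {..<k}" using f by (auto simp: PiE_iff)
  have km: "k \<le> m" unfolding k_def using fm by (rule Least_le)
  have am: "a m \<in> topspace (X m)" and coh: "\<And>i j. i < j \<Longrightarrow> a i = S i j (incl i) (a j)"
    using a by (auto simp: omega_space_def)
  have "S n k f (a k) = S n m f (a m)"
  proof (cases "k = m")
    case False
    then have "k < m" using km by simp
    then have inc: "incl k \<in> {..<k} \<rightarrow>\<^sub>E {..<m}" by (auto simp: incl_def)
    have "compose {..<n} (incl k) f = f"
      using fk by (auto simp: compose_def incl_def fun_eq_iff PiE_iff extensional_def)
    then show ?thesis
      using comp[OF fk inc am] coh[OF \<open>k < m\<close>] by simp
  qed simp
  then show ?thesis by (simp add: omega_map_def k_def Let_def)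
qed

text \<open>
  For finite \<open>A\<close> the elements of \<open>A\<close> in increasing order are
  \<open>enumerate A 0, \<dots>, enumerate A (card A - 1)\<close>.  Only the values of \<open>M\<close> on finite sets matter.
  In the last condition the open sets range over non-empty ones, since nothing can realize the
  empty set.
\<close>

definition is_model ::
  "(nat \<Rightarrow> 'a topology) \<Rightarrow> (nat \<Rightarrow> nat \<Rightarrow> (nat \<Rightarrow> nat) \<Rightarrow> 'a \<Rightarrow> 'a) \<Rightarrow> (nat set \<Rightarrow> 'a) \<Rightarrow> bool" where
  "is_model X S M \<longleftrightarrow>
     (\<forall>A. finite A \<longrightarrow>
        M A \<in> topspace (X (card A)) \<and>
        (\<forall>B g. finite B \<and> A \<subseteq> B \<and> g \<in> {..<card A} \<rightarrow>\<^sub>E {..<card B} \<and>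
             (\<forall>i<card A. enumerate A i = enumerate B (g i)) \<longrightarrow>
             M A = S (card A) (card B) g (M B)) \<and>
        (\<forall>m U. card A \<le> m \<and> U \<noteq> {} \<and>
             openin (subtopology (X m) (fibre X S (card A) m (M A))) U \<longrightarrow>
             (\<exists>B g. finite B \<and> card B = m \<and> A \<subseteq> B \<and>
                g \<in> {..<m} \<rightarrow>\<^sub>E {..<m} \<and> bij_betw g {..<m} {..<m} \<and>
                (\<forall>i<card A. enumerate A i = enumerate B (g i)) \<and>
                S m m g (M B) \<in> U)))"

definition model_of ::
  "(nat \<Rightarrow> nat \<Rightarrow> (nat \<Rightarrow> nat) \<Rightarrow> 'a \<Rightarrow> 'a) \<Rightarrow> (nat \<Rightarrow> 'a) \<Rightarrow> nat set \<Rightarrow> 'a" where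
  "model_of S \<sigma> A = omega_map S (card A) (\<lambda>i\<in>{..<card A}. enumerate A i) \<sigma>"

definition model_codes ::
  "(nat \<Rightarrow> 'a topology) \<Rightarrow> (nat \<Rightarrow> nat \<Rightarrow> (nat \<Rightarrow> nat) \<Rightarrow> 'a \<Rightarrow> 'a) \<Rightarrow> (nat \<Rightarrow> 'a) set" where
  "model_codes X S = {\<sigma> \<in> topspace (omega_space X S). is_model X S (model_of S \<sigma>)}"

definition model_space ::
  "(nat \<Rightarrow> 'a topology) \<Rightarrow> (nat \<Rightarrow> nat \<Rightarrow> (nat \<Rightarrow> nat) \<Rightarrow> 'a \<Rightarrow> 'a) \<Rightarrow> (nat \<Rightarrow> 'a) topology" where
  "model_space X S = subtopology (omega_space X S) (model_codes X S)"

definition enough_countable_models ::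
  "(nat \<Rightarrow> 'a topology) \<Rightarrow> (nat \<Rightarrow> nat \<Rightarrow> (nat \<Rightarrow> nat) \<Rightarrow> 'a \<Rightarrow> 'a) \<Rightarrow> bool" where
  "enough_countable_models X S \<longleftrightarrow>
     omega_space X S closure_of model_codes X S = topspace (omega_space X S)"

text \<open>
  Infinite two-player games with perfect information.  A move \<open>x\<close> is allowed after the history
  \<open>h\<close> (the list of all previous moves of both players) iff \<open>legal h x\<close>.  The second player
  makes the moves with odd index, and a strategy \<open>\<tau>\<close> for that player sees the whole history.
  A winning strategy has to answer every history that arises with a legal move, and has to win
  every infinite play.  In the games below a player can always repeat the previous move, so the
  only position that may have no legal move is the initial one; the second player then has a
  winning strategy.
\<close>

definition plays_by :: "('m list \<Rightarrow> 'm \<Rightarrow> bool) \<Rightarrow> ('m list \<Rightarrow> 'm) \<Rightarrow> 'm list \<Rightarrow> bool" where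
  "plays_by legal \<tau> h \<longleftrightarrow>
     (\<forall>i<length h. legal (take i h) (h ! i) \<and> (odd i \<longrightarrow> h ! i = \<tau> (take i h)))"

definition second_player_wins ::
  "('m list \<Rightarrow> 'm \<Rightarrow> bool) \<Rightarrow> ((nat \<Rightarrow> 'm) \<Rightarrow> bool) \<Rightarrow> bool" where
  "second_player_wins legal win \<longleftrightarrow>
     (\<exists>\<tau>. (\<forall>h. plays_by legal \<tau> h \<and> odd (length h) \<longrightarrow> legal h (\<tau> h)) \<and>
          (\<forall>x. (\<forall>k. plays_by legal \<tau> (map x [0..<k])) \<longrightarrow> win x))"

definition partial_omega_type ::
  "(nat \<Rightarrow> 'a topology) \<Rightarrow> (nat \<Rightarrow> nat \<Rightarrow> (nat \<Rightarrow> nat) \<Rightarrow> 'a \<Rightarrow> 'a) \<Rightarrow> (nat \<Rightarrow> 'a) set \<Rightarrow> bool" where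
  "partial_omega_type X S C \<longleftrightarrow> closedin (omega_space X S) C"

text \<open>\<open>omissible X S C F\<close>: \<open>F\<close> is omissible in a model realizing \<open>C\<close>.\<close>

definition omissible ::
  "(nat \<Rightarrow> 'a topology) \<Rightarrow> (nat \<Rightarrow> nat \<Rightarrow> (nat \<Rightarrow> nat) \<Rightarrow> 'a \<Rightarrow> 'a) \<Rightarrow>
   (nat \<Rightarrow> 'a) set \<Rightarrow> (nat \<Rightarrow> 'a) set \<Rightarrow> bool" where
  "omissible X S C F \<longleftrightarrow> (\<exists>\<sigma> \<in> model_codes X S \<inter> C. \<sigma> \<notin> F)"

text \<open>REALIZE is the first player and OMIT the second.\<close>

definition omitting_legal ::
  "(nat \<Rightarrow> 'a topology) \<Rightarrow> (nat \<Rightarrow> nat \<Rightarrow> (nat \<Rightarrow> nat) \<Rightarrow> 'a \<Rightarrow> 'a) \<Rightarrow>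
   (nat \<Rightarrow> 'a) set \<Rightarrow> (nat \<Rightarrow> 'a) set list \<Rightarrow> (nat \<Rightarrow> 'a) set \<Rightarrow> bool" where
  "omitting_legal X S C h F \<longleftrightarrow>
     partial_omega_type X S F \<and> omissible X S C F \<and> (h \<noteq> [] \<longrightarrow> last h \<subseteq> F)"

definition game_omitting_types_property ::
  "(nat \<Rightarrow> 'a topology) \<Rightarrow> (nat \<Rightarrow> nat \<Rightarrow> (nat \<Rightarrow> nat) \<Rightarrow> 'a \<Rightarrow> 'a) \<Rightarrow> bool" where
  "game_omitting_types_property X S \<longleftrightarrow>
     (\<forall>C. partial_omega_type X S C \<longrightarrow>
        second_player_wins (omitting_legal X S C) (\<lambda>F. omissible X S C (\<Union>n. F n)))"

text \<open>The Banach--Mazur game: EMPTY is the first player and NONEMPTY the second.\<close>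

definition banach_mazur_legal :: "'b topology \<Rightarrow> 'b set list \<Rightarrow> 'b set \<Rightarrow> bool" where
  "banach_mazur_legal Y h U \<longleftrightarrow> openin Y U \<and> U \<noteq> {} \<and> (h \<noteq> [] \<longrightarrow> U \<subseteq> last h)"

definition weakly_alpha_favourable :: "'b topology \<Rightarrow> bool" where
  "weakly_alpha_favourable Y \<longleftrightarrow>
     second_player_wins (banach_mazur_legal Y) (\<lambda>U. (\<Inter>n. U n) \<noteq> {})"

definition completely_weakly_alpha_favourable :: "'b topology \<Rightarrow> bool" where
  "completely_weakly_alpha_favourable Y \<longleftrightarrow>
     (\<forall>Z. closedin Y Z \<longrightarrow> weakly_alpha_favourable (subtopology Y Z))"

end

theory Submission
  imports Defs
begin

text \<open>
  Sending a closed set \<open>F\<close> to \<open>S\<^sub>\<W> \<inter> C - F\<close> turns the omitting types game on \<open>C\<close> into the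
  Banach--Mazur game on \<open>S\<^sub>\<W> \<inter> C\<close>, and every closed subset of \<open>S\<^sub>\<W>\<close> is of the form \<open>S\<^sub>\<W> \<inter> C\<close>.
  This map on moves is not injective, and an arbitrary closed preimage of a legal open move need
  not contain the previous closed move; adding the previous move to it does not change its image.
  Hence every move of the Banach--Mazur game can be lifted, and winning strategies transfer in
  both directions.
\<close>

lemma plays_by_snoc:
  "plays_by legal \<tau> (h @ [x]) \<longleftrightarrow>
     plays_by legal \<tau> h \<and> legal h x \<and> (odd (length h) \<longrightarrow> x = \<tau> h)"
  by (auto simp: plays_by_def less_Suc_eq nth_append)

lemma plays_by_imp_legal:
  "plays_by legal \<tau> h \<Longrightarrow> \<forall>i<length h. legal (take i h) (h ! i)"
  by (simp add: plays_by_def)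

text \<open>The winner in one game shadows a play of the other game. Pushing a history forward is
  just \<open>map \<phi>\<close>. Pulling one back needs choices, and these must depend only on
  earlier moves, so that the lifts of longer histories extend those of shorter ones.\<close>

lemma second_player_wins_morphism:
  assumes push_move: "\<And>h x. legal h x \<Longrightarrow> legal' (map \<phi> h) (\<phi> x)"
    and lift_move: "\<And>h y. \<lbrakk>\<forall>i<length h. legal (take i h) (h ! i); legal' (map \<phi> h) y\<rbrakk>
                \<Longrightarrow> \<exists>x. legal h x \<and> \<phi> x = y"
    and win: "\<And>x. win x \<longleftrightarrow> win' (\<lambda>n. \<phi> (x n))"
  shows "second_player_wins legal win \<longleftrightarrow> second_player_wins legal' win'"
proof
  assume "second_player_wins legal win"
  then obtain \<tau> where legal_\<tau>: "\<And>h. plays_by legal \<tau> h \<Longrightarrow> odd (length h) \<Longrightarrow> legal h (\<tau> h)"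
    and win_\<tau>: "\<And>x. (\<And>k. plays_by legal \<tau> (map x [0..<k])) \<Longrightarrow> win x"
    unfolding second_player_wins_def by blast
  \<comment> \<open>At even positions any legal preimage of the opponent's move \<open>y\<close>
    will do. At odd positions \<open>y\<close> is ignored: along a play by \<open>\<tau>'\<close> it
    equals \<open>\<phi> (\<tau> h)\<close>, so \<open>\<tau> h\<close> is itself a
    preimage.\<close>
  define next_move where "next_move y h =
    (if odd (length h) then \<tau> h else SOME x. legal h x \<and> \<phi> x = y)" for y h
  define lift where "lift h' = fold (\<lambda>y h. h @ [next_move y h]) h' []" for h'
  define \<tau>' where "\<tau>' h' = \<phi> (\<tau> (lift h'))" for h'
  have lift_snoc: "lift (h' @ [y]) = lift h' @ [next_move y (lift h')]" for h' y
    by (simp add: lift_def)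
  have length_lift: "length (lift h') = length h'" for h'
    by (induction h' rule: rev_induct) (simp_all add: lift_snoc, simp add: lift_def)
  have lift: "plays_by legal \<tau> (lift h') \<and> map \<phi> (lift h') = h'" if "plays_by legal' \<tau>' h'" for h'
    using that
  proof (induction h' rule: rev_induct)
    case Nil
    then show ?case by (simp add: lift_def plays_by_def)
  next
    case (snoc y h')
    then have IH: "plays_by legal \<tau> (lift h')" "map \<phi> (lift h') = h'"
      and y: "legal' h' y" "odd (length h') \<Longrightarrow> y = \<tau>' h'"
      by (auto simp: plays_by_snoc)
    have "legal (lift h') (next_move y (lift h')) \<and> \<phi> (next_move y (lift h')) = y"
    proof (cases "odd (length h')")
      case True
      then show ?thesis
        using y(2) legal_\<tau>[OF IH(1)] by (simp add: next_move_def length_lift \<tau>'_def)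
    next
      case False
      have "\<exists>x. legal (lift h') x \<and> \<phi> x = y"
        using lift_move[OF plays_by_imp_legal[OF IH(1)]] IH(2) y(1) by simp
      then show ?thesis
        using False by (simp add: next_move_def length_lift) (rule someI_ex)
    qed
    then show ?case
      using IH by (simp add: lift_snoc plays_by_snoc next_move_def)
  qed
  have "legal' h' (\<tau>' h')" if "plays_by legal' \<tau>' h'" "odd (length h')" for h'
    using push_move[OF legal_\<tau>[of "lift h'"]] lift[OF that(1)] that(2)
    by (simp add: \<tau>'_def length_lift)
  moreover have "win' x'" if x': "\<forall>k. plays_by legal' \<tau>' (map x' [0..<k])" for x'
  proof -
    \<comment> \<open>The lifts of the finite prefixes of \<open>x'\<close> extend one another;
      \<open>x\<close> is their limit, a play by \<open>\<tau>\<close>.\<close>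
    define x where "x k = next_move (x' k) (lift (map x' [0..<k]))" for k
    have lift_x: "lift (map x' [0..<k]) = map x [0..<k]" for k
      by (induction k) (simp_all add: lift_snoc x_def, simp add: lift_def)
    have "win x"
      using win_\<tau> lift x' by (metis lift_x)
    \<comment> \<open>The prefix of length \<open>Suc n\<close> is the shortest one containing the
      entry with index \<open>n\<close>.\<close>
    moreover have "\<phi> (x n) = x' n" for n
      using lift[OF x'[rule_format, of "Suc n"]] unfolding lift_x by simp
    ultimately show ?thesis
      by (simp add: win)
  qed
  ultimately show "second_player_wins legal' win'"
    unfolding second_player_wins_def by blast
next
  assume "second_player_wins legal' win'"
  then obtain \<tau>' where
    legal_\<tau>': "\<And>h. plays_by legal' \<tau>' h \<Longrightarrow> odd (length h) \<Longrightarrow> legal' h (\<tau>' h)"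
    and win_\<tau>': "\<And>x. (\<And>k. plays_by legal' \<tau>' (map x [0..<k])) \<Longrightarrow> win' x"
    unfolding second_player_wins_def by blast
  define \<tau> where "\<tau> h = (SOME x. legal h x \<and> \<phi> x = \<tau>' (map \<phi> h))" for h
  \<comment> \<open>Answers of \<open>\<tau>'\<close> are known to be legal only along its own
    plays, hence the second premise; \<open>push\<close> supplies it by induction on the
    history.\<close>
  have \<tau>: "legal h (\<tau> h) \<and> \<phi> (\<tau> h) = \<tau>' (map \<phi> h)"
    if "plays_by legal \<tau> h" "plays_by legal' \<tau>' (map \<phi> h)" "odd (length h)" for h
  proof -
    have "legal' (map \<phi> h) (\<tau>' (map \<phi> h))"
      using legal_\<tau>'[OF that(2)] that(3) by simp
    from lift_move[OF plays_by_imp_legal[OF that(1)] this] show ?thesis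
      unfolding \<tau>_def by (rule someI_ex)
  qed
  have push: "plays_by legal' \<tau>' (map \<phi> h)" if "plays_by legal \<tau> h" for h
    using that
  proof (induction h rule: rev_induct)
    case Nil
    then show ?case by (simp add: plays_by_def)
  next
    case (snoc x h)
    then show ?case
      using \<tau>[of h] push_move by (auto simp: plays_by_snoc)
  qed
  have "legal h (\<tau> h)" if "plays_by legal \<tau> h" "odd (length h)" for h
    using \<tau> push that by blast
  moreover have "win x" if x: "\<forall>k. plays_by legal \<tau> (map x [0..<k])" for x
    unfolding win
    by (rule win_\<tau>') (use push[OF x[rule_format]] in \<open>simp add: comp_def\<close>)
  ultimately show "second_player_wins legal win"
    unfolding second_player_wins_def by blast
qed

text \<open>Under \<open>F \<mapsto> Z - F\<close>, omissible means non-empty image, increasing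
  sequences become decreasing, and the union of the moves becomes the intersection of their
  images.\<close>

lemma omitting_types_game_iff_Banach_Mazur_game:
  fixes X S C
  defines "Z \<equiv> model_codes X S \<inter> C"
  assumes C: "partial_omega_type X S C"
  shows "second_player_wins (omitting_legal X S C) (\<lambda>F. omissible X S C (\<Union>n. F n)) \<longleftrightarrow>
         weakly_alpha_favourable (subtopology (model_space X S) Z)"
proof -
  let ?\<Omega> = "omega_space X S" and ?\<phi> = "\<lambda>F. Z - F"
  have Z_sub: "Z \<subseteq> topspace ?\<Omega>"
    by (auto simp: Z_def model_codes_def)
  have top: "subtopology (model_space X S) Z = subtopology ?\<Omega> Z"
    by (simp add: model_space_def subtopology_subtopology Z_def flip: Int_assoc)
  have openin_Z: "openin (subtopology ?\<Omega> Z) U \<longleftrightarrow> (\<exists>F. closedin ?\<Omega> F \<and> U = Z - F)" for U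
  proof
    assume "openin (subtopology ?\<Omega> Z) U"
    then obtain V where V: "openin ?\<Omega> V" "U = V \<inter> Z"
      by (auto simp: openin_subtopology)
    show "\<exists>F. closedin ?\<Omega> F \<and> U = Z - F"
      by (rule exI[of _ "topspace ?\<Omega> - V"]) (use V Z_sub in auto)
  next
    assume "\<exists>F. closedin ?\<Omega> F \<and> U = Z - F"
    then obtain F where F: "closedin ?\<Omega> F" "U = Z - F" by blast
    then have "U = (topspace ?\<Omega> - F) \<inter> Z" using Z_sub by auto
    then show "openin (subtopology ?\<Omega> Z) U"
      using F(1) by (auto simp: openin_subtopology)
  qed
  show ?thesis
    unfolding weakly_alpha_favourable_def top
  proof (rule second_player_wins_morphism[where \<phi> = ?\<phi>])
    fix h F
    assume "omitting_legal X S C h F"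
    then show "banach_mazur_legal (subtopology ?\<Omega> Z) (map ?\<phi> h) (Z - F)"
      by (auto simp: omitting_legal_def banach_mazur_legal_def partial_omega_type_def
          omissible_def openin_Z last_map) (auto simp: Z_def)
  next
    fix h U
    assume h: "\<forall>i<length h. omitting_legal X S C (take i h) (h ! i)"
      and U: "banach_mazur_legal (subtopology ?\<Omega> Z) (map ?\<phi> h) U"
    \<comment> \<open>The previous move, or the empty set before the opening move. Its closedness is
      where legality of the history is needed.\<close>
    define L where "L = (if h = [] then {} else last h)"
    have L: "closedin ?\<Omega> L"
      using h[rule_format, of "length h - 1"]
      by (auto simp: L_def last_conv_nth omitting_legal_def partial_omega_type_def)
    obtain F where F: "closedin ?\<Omega> F" "U = Z - F"
      using U by (auto simp: banach_mazur_legal_def openin_Z)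
    have "U \<subseteq> Z - L"
      using U F by (auto simp: banach_mazur_legal_def L_def last_map)
    then have "Z - (F \<union> L) = U"
      using F by auto
    moreover have "omitting_legal X S C h (F \<union> L)"
      unfolding omitting_legal_def partial_omega_type_def omissible_def
    proof (intro conjI)
      show "closedin ?\<Omega> (F \<union> L)"
        using F(1) L by blast
      show "\<exists>\<sigma>\<in>model_codes X S \<inter> C. \<sigma> \<notin> F \<union> L"
        using U \<open>Z - (F \<union> L) = U\<close> by (auto simp: banach_mazur_legal_def Z_def)
    qed (simp add: L_def)
    ultimately show "\<exists>F. omitting_legal X S C h F \<and> Z - F = U"
      by blast
  next
    fix F :: "nat \<Rightarrow> (nat \<Rightarrow> 'a) set"
    show "omissible X S C (\<Union>n. F n) \<longleftrightarrow> (\<Inter>n. Z - F n) \<noteq> {}"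
      by (auto simp: omissible_def Z_def)
  qed
qed

theorem theorem2p4:
  fixes X :: "nat \<Rightarrow> 'a topology"
    and S :: "nat \<Rightarrow> nat \<Rightarrow> (nat \<Rightarrow> nat) \<Rightarrow> 'a \<Rightarrow> 'a"
  assumes "type_space_functor X S"
    and "enough_countable_models X S"
  shows "game_omitting_types_property X S \<longleftrightarrow>
         completely_weakly_alpha_favourable (model_space X S)"
proof -
  \<comment> \<open>Different \<open>C\<close> may have the same trace on
    \<open>model_codes X S\<close>; this is harmless, since both properties are universal statements
    about traces.\<close>
  have closedin_model_space: "closedin (model_space X S) Z \<longleftrightarrow>
      (\<exists>C. partial_omega_type X S C \<and> Z = model_codes X S \<inter> C)" for Z
    by (auto simp: model_space_def closedin_subtopology partial_omega_type_def Int_commute)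
  have "game_omitting_types_property X S \<longleftrightarrow>
      (\<forall>C. partial_omega_type X S C \<longrightarrow>
        weakly_alpha_favourable (subtopology (model_space X S) (model_codes X S \<inter> C)))"
    by (simp add: game_omitting_types_property_def omitting_types_game_iff_Banach_Mazur_game)
  also have "\<dots> \<longleftrightarrow> completely_weakly_alpha_favourable (model_space X S)"
    by (auto simp: completely_weakly_alpha_favourable_def closedin_model_space)
  finally show ?thesis .
qed

end
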